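(* Let $\Sigma$ be a finite alphabet and $\mathcal{B}\subseteq\mathcal{P}(\Sigma^* )$ a Boolean subalgebra closed under left and right quotients by words. Then a language $K\subseteq\Sigma^*$ belongs to $\mathcal{B}\oplus 2$ if, and only if, $K$ satisfies every ultrafilter equation in $\mathcal{E}(\mathcal{B}\oplus 2)$.
   Context: Left and right quotients: $w^{-1}L=\{u\mid wu\in L\}$, $Lw^{-1}=\{u\mid uw\in L\}$. For Boolean algebras $\mathcal{B}_1,\mathcal{B}_2\subseteq\mathcal{P}(\Sigma^* )$ closed under quotients, $\mathcal{B}_1\oplus\mathcal{B}_2$ is the Boolean algebra generated by $\mathcal{B}_1\cup\mathcal{B}_2\cup\{L_1aL_2\mid L_1\in\mathcal{B}_1,L_2\in\mathcal{B}_2,a\in\Sigma\}$; $\mathcal{B}\oplus 2$ denotes this with $\mathcal{B}_2=\{\emptyset,\Sigma^*\}$ the two-element Boolean algebra (so it is generated by $\mathcal{B}\cup\{La\Sigma^*\mid L\in\mathcal{B},a\in\Sigma\}$). For a set $S$, $\beta(S)$ is the set of ultrafilters on $\mathcal{P}(S)$; for $f\colon S\to T$, $\beta f\colon\beta(S)\to\beta(T)$ is given by $L\in\beta f(\mu)$ iff $f^{-1}(L)\in\mu$. An ultrafilter equation is a pair $\mu\approx\nu$ with $\mu,\nu\in\beta(\Sigma^* )$; $L\subseteq\Sigma^*$ satisfies it if ($L\in\mu\iff L\in\nu$), and a Boolean algebra satisfies it ("it holds in" the algebra) if every element does. Let $\Sigma^*\otimes\mathbb{N}=\{(w,i)\in\Sigma^*\times\mathbb{N}\mid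 i<|w|\}$. For $a\in\Sigma$ let $f_a\colon\Sigma^*\otimes\mathbb{N}\to\Sigma^*$, $(w,i)\mapsto w(a@i)$ (the word $w=w_0\cdots w_{|w|-1}$ with its $i$th letter replaced by $a$), and $f_r\colon\Sigma^*\otimes\mathbb{N}\to\Sigma^*$, $(w,i)\mapsto w_0\cdots w_{i-1}$. $\mathcal{E}(\mathcal{B}\oplus 2)$ is the set of equations $\mu\approx\nu$ such that: (i) $\mu\approx\nu$ holds in $\mathcal{B}$; (ii) for each $a\in\Sigma$ and each $\gamma\in\beta(\Sigma^*\otimes\mathbb{N})$ with $\mu=\beta f_a(\gamma)$ there is $\delta\in\beta(\Sigma^*\otimes\mathbb{N})$ with $\nu=\beta f_a(\delta)$ and $\beta f_r(\gamma)\approx\beta f_r(\delta)$ holding in $\mathcal{B}$; (iii) symmetrically, for each $a\in\Sigma$ and each $\delta$ with $\nu=\beta f_a(\delta)$ there is $\gamma$ with $\mu=\beta f_a(\gamma)$ and $\beta f_r(\gamma)\approx\beta f_r(\delta)$ holding in $\mathcal{B}$. *)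

theory Defs
  imports "HOL-Analysis.Sigma_Algebra"
begin

text \<open>
  The alphabet is a set \<^term>\<open>\<Sigma> :: 'a set\<close>, so that \<^term>\<open>lists \<Sigma>\<close> is the set of words over it.
  A Boolean subalgebra of the powerset of \<^term>\<open>\<Omega>\<close> is a family \<^term>\<open>M\<close> with \<^term>\<open>algebra \<Omega> M\<close>.
\<close>

definition left_quotient :: "'a list \<Rightarrow> 'a list set \<Rightarrow> 'a list set" where
  "left_quotient w L = {u. w @ u \<in> L}"

definition right_quotient :: "'a list set \<Rightarrow> 'a list \<Rightarrow> 'a list set" where
  "right_quotient L w = {u. u @ w \<in> L}"

definition closed_under_quotients :: "'a set \<Rightarrow> 'a list set set \<Rightarrow> bool" where
  "closed_under_quotients \<Sigma> B \<longleftrightarrow>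
     (\<forall>L\<in>B. \<forall>w\<in>lists \<Sigma>. left_quotient w L \<in> B \<and> right_quotient L w \<in> B)"

definition marked_product :: "'a list set \<Rightarrow> 'a \<Rightarrow> 'a list set \<Rightarrow> 'a list set" where
  "marked_product L1 a L2 = {u @ [a] @ v | u v. u \<in> L1 \<and> v \<in> L2}"

definition oplus :: "'a set \<Rightarrow> 'a list set set \<Rightarrow> 'a list set set \<Rightarrow> 'a list set set" where
  "oplus \<Sigma> B1 B2 =
     algebra (lists \<Sigma>) hull
       (B1 \<union> B2 \<union> {marked_product L1 a L2 | L1 a L2. L1 \<in> B1 \<and> a \<in> \<Sigma> \<and> L2 \<in> B2})"

definition oplus_two :: "'a set \<Rightarrow> 'a list set set \<Rightarrow> 'a list set set" where
  "oplus_two \<Sigma> B = oplus \<Sigma> B {{}, lists \<Sigma>}"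

definition ultrafilters :: "'s set \<Rightarrow> 's set set set" where
  "ultrafilters S = {\<mu>. \<mu> \<subseteq> Pow S \<and> S \<in> \<mu> \<and> {} \<notin> \<mu> \<and>
     (\<forall>X\<in>\<mu>. \<forall>Y\<in>\<mu>. X \<inter> Y \<in> \<mu>) \<and>
     (\<forall>X\<in>\<mu>. \<forall>Y. X \<subseteq> Y \<and> Y \<subseteq> S \<longrightarrow> Y \<in> \<mu>) \<and>
     (\<forall>X. X \<subseteq> S \<longrightarrow> X \<in> \<mu> \<or> S - X \<in> \<mu>)}"

text \<open>
  In \<open>ultrafilter_map S T f\<close>, only the values of \<open>f\<close> on \<open>S\<close> matter, and they are meant to lie in \<open>T\<close>.
\<close>

definition ultrafilter_map :: "'s set \<Rightarrow> 't set \<Rightarrow> ('s \<Rightarrow> 't) \<Rightarrow> 's set set \<Rightarrow> 't set set" where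
  "ultrafilter_map S T f \<mu> = {L. L \<subseteq> T \<and> {x \<in> S. f x \<in> L} \<in> \<mu>}"

definition satisfies_eq :: "'s set \<Rightarrow> 's set set \<times> 's set set \<Rightarrow> bool" where
  "satisfies_eq L = (\<lambda>(\<mu>, \<nu>). L \<in> \<mu> \<longleftrightarrow> L \<in> \<nu>)"

definition holds_in :: "'s set set \<times> 's set set \<Rightarrow> 's set set \<Rightarrow> bool" where
  "holds_in e B \<longleftrightarrow> (\<forall>L\<in>B. satisfies_eq L e)"

definition pointed_words :: "'a set \<Rightarrow> ('a list \<times> nat) set" where
  "pointed_words \<Sigma> = {(w, i). w \<in> lists \<Sigma> \<and> i < length w}"

definition replace_letter :: "'a \<Rightarrow> 'a list \<times> nat \<Rightarrow> 'a list" where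
  "replace_letter a = (\<lambda>(w, i). w[i := a])"

definition prefix_before :: "'a list \<times> nat \<Rightarrow> 'a list" where
  "prefix_before = (\<lambda>(w, i). take i w)"

abbreviation beta_replace :: "'a set \<Rightarrow> 'a \<Rightarrow> ('a list \<times> nat) set set \<Rightarrow> 'a list set set" where
  "beta_replace \<Sigma> a \<equiv> ultrafilter_map (pointed_words \<Sigma>) (lists \<Sigma>) (replace_letter a)"

abbreviation beta_prefix :: "'a set \<Rightarrow> ('a list \<times> nat) set set \<Rightarrow> 'a list set set" where
  "beta_prefix \<Sigma> \<equiv> ultrafilter_map (pointed_words \<Sigma>) (lists \<Sigma>) prefix_before"

definition equations_oplus_two ::
    "'a set \<Rightarrow> 'a list set set \<Rightarrow> ('a list set set \<times> 'a list set set) set" where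
  "equations_oplus_two \<Sigma> B =
     {(\<mu>, \<nu>). \<mu> \<in> ultrafilters (lists \<Sigma>) \<and> \<nu> \<in> ultrafilters (lists \<Sigma>) \<and>
        holds_in (\<mu>, \<nu>) B \<and>
        (\<forall>a\<in>\<Sigma>. \<forall>\<gamma>\<in>ultrafilters (pointed_words \<Sigma>). \<mu> = beta_replace \<Sigma> a \<gamma> \<longrightarrow>
           (\<exists>\<delta>\<in>ultrafilters (pointed_words \<Sigma>). \<nu> = beta_replace \<Sigma> a \<delta> \<and>
              holds_in (beta_prefix \<Sigma> \<gamma>, beta_prefix \<Sigma> \<delta>) B)) \<and>
        (\<forall>a\<in>\<Sigma>. \<forall>\<delta>\<in>ultrafilters (pointed_words \<Sigma>). \<nu> = beta_replace \<Sigma> a \<delta> \<longrightarrow>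
           (\<exists>\<gamma>\<in>ultrafilters (pointed_words \<Sigma>). \<mu> = beta_replace \<Sigma> a \<gamma> \<and>
              holds_in (beta_prefix \<Sigma> \<gamma>, beta_prefix \<Sigma> \<delta>) B))}"

end

theory Submission
  imports Defs
begin

text \<open>
  The bridge between languages and equations is the identity \<open>L a \<Sigma>* = f\<^sub>a (f\<^sub>r\<^sup>-\<^sup>1 L)\<close>.
  By compactness, an ultrafilter \<open>\<mu>\<close> contains \<open>f\<^sub>a D\<close> for all \<open>D\<close> in a family closed under
  intersection precisely when \<open>\<mu> = \<beta>f\<^sub>a(\<gamma>)\<close> for some \<open>\<gamma>\<close> containing that family. Hence the equations
  of \<open>\<E>(\<B> \<oplus> 2)\<close> are exactly the pairs of ultrafilters that agree on \<open>\<B> \<oplus> 2\<close>, and any Boolean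
  subalgebra of a powerset consists of the sets that respect all such pairs.
\<close>

section \<open>Ultrafilters on a set and their existence\<close>

lemma ultrafiltersD:
  assumes "\<mu> \<in> ultrafilters S"
  shows ultrafilter_subset: "X \<in> \<mu> \<Longrightarrow> X \<subseteq> S"
    and ultrafilter_space: "S \<in> \<mu>"
    and ultrafilter_not_empty: "{} \<notin> \<mu>"
    and ultrafilter_Int: "X \<in> \<mu> \<Longrightarrow> Y \<in> \<mu> \<Longrightarrow> X \<inter> Y \<in> \<mu>"
    and ultrafilter_mono: "X \<in> \<mu> \<Longrightarrow> X \<subseteq> Y \<Longrightarrow> Y \<subseteq> S \<Longrightarrow> Y \<in> \<mu>"
    and ultrafilter_cases: "X \<subseteq> S \<Longrightarrow> X \<in> \<mu> \<or> S - X \<in> \<mu>"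
  using assms unfolding ultrafilters_def by blast+

lemma ultrafilter_meets:
  assumes "\<mu> \<in> ultrafilters S" "X \<in> \<mu>" "Y \<in> \<mu>"
  shows "X \<inter> Y \<noteq> {}"
  using ultrafilter_Int[OF assms] ultrafilter_not_empty[OF assms(1)] by metis

lemma ultrafilter_Compl_iff:
  assumes "\<mu> \<in> ultrafilters S" "X \<subseteq> S"
  shows "S - X \<in> \<mu> \<longleftrightarrow> X \<notin> \<mu>"
  using ultrafilter_cases[OF assms] ultrafilter_meets[OF assms(1), of X "S - X"] by blast

lemma ultrafilter_Int_iff:
  assumes "\<mu> \<in> ultrafilters S" "X \<subseteq> S" "Y \<subseteq> S"
  shows "X \<inter> Y \<in> \<mu> \<longleftrightarrow> X \<in> \<mu> \<and> Y \<in> \<mu>"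
  using ultrafilter_Int[OF assms(1)] ultrafilter_mono[OF assms(1), of "X \<inter> Y"] assms(2,3)
  by blast

text \<open>This is how a set \<open>E\<close> is forced into a filter base: its traces on the
  members are added. It serves both the maximality argument of Zorn's lemma and the choice of
  ultrafilters on either side of \<open>K\<close>.\<close>

lemma Int_closed_adjoin:
  assumes Int: "\<And>X Y. X \<in> F \<Longrightarrow> Y \<in> F \<Longrightarrow> X \<inter> Y \<in> F"
    and X: "X \<in> F \<union> (\<lambda>Z. Z \<inter> E) ` F" and Y: "Y \<in> F \<union> (\<lambda>Z. Z \<inter> E) ` F"
  shows "X \<inter> Y \<in> F \<union> (\<lambda>Z. Z \<inter> E) ` F"
proof -
  obtain Z Z' where Z: "Z \<in> F" "X = Z \<or> X = Z \<inter> E" "Z' \<in> F" "Y = Z' \<or> Y = Z' \<inter> E"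
    using X Y by blast
  then have "X \<inter> Y = Z \<inter> Z' \<or> X \<inter> Y = (Z \<inter> Z') \<inter> E" by blast
  then show ?thesis using Int[OF Z(1,3)] by (metis UnI1 UnI2 image_eqI)
qed

text \<open>Zorn's lemma yields a maximal intersection-closed family above \<open>C\<close> without
  \<open>{}\<close>. By maximality it contains every subset of \<open>S\<close> that meets all its
  members, and the ultrafilter axioms follow.\<close>

lemma ultrafilter_extension:
  assumes sub: "C \<subseteq> Pow S" and top: "S \<in> C" and ne: "{} \<notin> C"
    and Int: "\<And>X Y. X \<in> C \<Longrightarrow> Y \<in> C \<Longrightarrow> X \<inter> Y \<in> C"
  obtains \<mu> where "\<mu> \<in> ultrafilters S" "C \<subseteq> \<mu>"
proof -
  \<comment> \<open>Upward closure is not imposed, so that adjoining traces stays inside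
    \<open>P\<close>; it is recovered from maximality afterwards.\<close>
  define P where "P = {F. C \<subseteq> F \<and> F \<subseteq> Pow S \<and> {} \<notin> F \<and> (\<forall>X\<in>F. \<forall>Y\<in>F. X \<inter> Y \<in> F)}"
  have "\<exists>M\<in>P. \<forall>X\<in>P. M \<subseteq> X \<longrightarrow> X = M"
  proof (rule subset_Zorn_nonempty)
    have "C \<in> P"
      using sub ne Int by (simp add: P_def)
    then show "P \<noteq> {}" by blast
  next
    fix \<C> assume ne': "\<C> \<noteq> {}" and ch: "subset.chain P \<C>"
    have in_P: "F \<in> P" if "F \<in> \<C>" for F
      using ch that by (auto simp: subset_chain_def)
    have "X \<inter> Y \<in> \<Union>\<C>" if XY: "X \<in> \<Union>\<C>" "Y \<in> \<Union>\<C>" for X Y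
    proof -
      obtain F G where FG: "F \<in> \<C>" "X \<in> F" "G \<in> \<C>" "Y \<in> G" using XY by blast
      then have "F \<subseteq> G \<or> G \<subseteq> F" using ch by (auto simp: subset_chain_def)
      then obtain H where H: "H \<in> \<C>" "X \<in> H" "Y \<in> H" using FG by blast
      then have "X \<inter> Y \<in> H" using in_P[OF H(1)] by (simp add: P_def)
      then show ?thesis using H(1) by blast
    qed
    moreover have "C \<subseteq> \<Union>\<C>" "\<Union>\<C> \<subseteq> Pow S" "{} \<notin> \<Union>\<C>"
      using ne' in_P unfolding P_def by blast+
    ultimately show "\<Union>\<C> \<in> P"
      unfolding P_def by blast
  qed
  then obtain M where M: "M \<in> P" and max: "\<And>F. F \<in> P \<Longrightarrow> M \<subseteq> F \<Longrightarrow> F = M"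
    by blast
  have CM: "C \<subseteq> M" "M \<subseteq> Pow S" "{} \<notin> M" and MI: "\<And>X Y. X \<in> M \<Longrightarrow> Y \<in> M \<Longrightarrow> X \<inter> Y \<in> M"
    using M by (simp_all add: P_def)
  have mem: "Y \<in> M" if Y: "Y \<subseteq> S" "\<And>X. X \<in> M \<Longrightarrow> X \<inter> Y \<noteq> {}" for Y
  proof -
    let ?G = "M \<union> (\<lambda>X. X \<inter> Y) ` M"
    have "\<forall>X\<in>?G. \<forall>X'\<in>?G. X \<inter> X' \<in> ?G"
      by (intro ballI) (rule Int_closed_adjoin[OF MI])
    moreover have "{} \<notin> ?G" "?G \<subseteq> Pow S" "C \<subseteq> ?G" using CM Y by blast+
    ultimately have "?G \<in> P" by (simp add: P_def)
    then have "?G = M" using max by blast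
    \<comment> \<open>The trace of the whole space is \<open>Y\<close> itself, which therefore lies
      in \<open>?G = M\<close>.\<close>
    moreover have "S \<inter> Y \<in> ?G" using top CM by blast
    ultimately show ?thesis using Y(1) by (simp add: Int_absorb1)
  qed
  have up: "Y \<in> M" if "X \<in> M" "X \<subseteq> Y" "Y \<subseteq> S" for X Y
  proof (rule mem[OF that(3)])
    fix Z assume "Z \<in> M"
    then have "Z \<inter> X \<in> M" using MI that(1) by blast
    then show "Z \<inter> Y \<noteq> {}" using CM(3) that(2) by (metis Int_mono order_refl subset_empty)
  qed
  have "X \<in> M \<or> S - X \<in> M" if X: "X \<subseteq> S" for X
  proof (rule disjCI)
    assume "S - X \<notin> M"
    \<comment> \<open>A member of \<open>M\<close> disjoint from \<open>X\<close> would be contained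
      in \<open>S - X\<close> and so put \<open>S - X\<close> into \<open>M\<close>.\<close>
    then have "Z \<inter> X \<noteq> {}" if "Z \<in> M" for Z
      using up[OF that, of "S - X"] that CM(2) by blast
    then show "X \<in> M" using mem[OF X] by blast
  qed
  then have "M \<in> ultrafilters S"
    unfolding ultrafilters_def using CM top MI up by auto
  then show ?thesis using CM(1) by (rule that)
qed

section \<open>Lifting ultrafilters along maps\<close>

lemma ultrafilter_map_lift:
  assumes \<mu>: "\<mu> \<in> ultrafilters T" and f: "f \<in> S \<rightarrow> T"
    and sub: "\<D> \<subseteq> Pow S" and top: "S \<in> \<D>"
    and Int: "\<And>X Y. X \<in> \<D> \<Longrightarrow> Y \<in> \<D> \<Longrightarrow> X \<inter> Y \<in> \<D>"
    and img: "\<And>D. D \<in> \<D> \<Longrightarrow> f ` D \<in> \<mu>"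
  obtains \<gamma> where "\<gamma> \<in> ultrafilters S" "\<D> \<subseteq> \<gamma>" "\<mu> = ultrafilter_map S T f \<gamma>"
proof -
  let ?C = "{{x \<in> S. f x \<in> X} \<inter> D | X D. X \<in> \<mu> \<and> D \<in> \<D>}"
  have whole: "{x \<in> S. f x \<in> T} = S" using f by blast
  have C_I: "{x \<in> S. f x \<in> X} \<in> ?C" if "X \<in> \<mu>" for X
    using that top by blast
  have C_D: "D \<in> ?C" if "D \<in> \<D>" for D
  proof -
    have "D = {x \<in> S. f x \<in> T} \<inter> D" using whole that sub by blast
    then show ?thesis using that ultrafilter_space[OF \<mu>] by blast
  qed
  have C_ne: "{} \<notin> ?C"
  proof
    assume "{} \<in> ?C"
    then obtain X D where XD: "X \<in> \<mu>" "D \<in> \<D>" "{x \<in> S. f x \<in> X} \<inter> D = {}" by auto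
    then show False
      using ultrafilter_meets[OF \<mu> XD(1) img[OF XD(2)]] sub by blast
  qed
  have C_Int: "Y \<inter> Y' \<in> ?C" if YY: "Y \<in> ?C" "Y' \<in> ?C" for Y Y'
  proof -
    obtain X D X' D' where XD: "Y = {x \<in> S. f x \<in> X} \<inter> D" "X \<in> \<mu>" "D \<in> \<D>"
      "Y' = {x \<in> S. f x \<in> X'} \<inter> D'" "X' \<in> \<mu>" "D' \<in> \<D>"
      using YY by auto
    then have "Y \<inter> Y' = {x \<in> S. f x \<in> X \<inter> X'} \<inter> (D \<inter> D')" by blast
    then show ?thesis using Int[OF XD(3,6)] ultrafilter_Int[OF \<mu> XD(2,5)] by blast
  qed
  have C_sub: "?C \<subseteq> Pow S" by blast
  obtain \<gamma> where \<gamma>: "\<gamma> \<in> ultrafilters S" "?C \<subseteq> \<gamma>"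
    by (rule ultrafilter_extension[OF C_sub C_D[OF top] C_ne C_Int])
  \<comment> \<open>The base gives only that \<open>\<mu>\<close> is included in the image of
    \<open>\<gamma>\<close>. For the converse, a set outside \<open>\<mu>\<close> has its complement
    in \<open>\<mu>\<close>, and the two disjoint preimages cannot both lie in
    \<open>\<gamma>\<close>.\<close>
  have "X \<in> \<mu>" if X: "X \<subseteq> T" "{x \<in> S. f x \<in> X} \<in> \<gamma>" for X
  proof (rule ccontr)
    assume "X \<notin> \<mu>"
    then have "{x \<in> S. f x \<in> T - X} \<in> \<gamma>"
      using C_I[of "T - X"] \<gamma>(2) ultrafilter_Compl_iff[OF \<mu> X(1)] by blast
    then show False using ultrafilter_meets[OF \<gamma>(1) X(2)] by blast
  qed
  then have "\<mu> = ultrafilter_map S T f \<gamma>"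
    unfolding ultrafilter_map_def using C_I \<gamma>(2) ultrafilter_subset[OF \<mu>] by blast
  moreover have "\<D> \<subseteq> \<gamma>" using C_D \<gamma>(2) by blast
  ultimately show ?thesis using that \<gamma>(1) by blast
qed

text \<open>\<open>D\<close> is contained in the preimage of its own image. This shows that the
  condition \<open>img\<close> of \<open>ultrafilter_map_lift\<close> is also necessary.\<close>

lemma image_in_ultrafilter_map:
  assumes "\<gamma> \<in> ultrafilters S" "f \<in> S \<rightarrow> T" "D \<in> \<gamma>"
  shows "f ` D \<in> ultrafilter_map S T f \<gamma>"
proof -
  have "D \<subseteq> S" using ultrafilter_subset[OF assms(1,3)] .
  then have "f ` D \<subseteq> T" "D \<subseteq> {x \<in> S. f x \<in> f ` D}" using assms(2) by blast+
  then show ?thesis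
    unfolding ultrafilter_map_def using ultrafilter_mono[OF assms(1,3)] by blast
qed

section \<open>Separating a set from a Boolean algebra\<close>

text \<open>If \<open>K\<close> is not in \<open>A\<close>, some ultrafilter of the Boolean algebra
  \<open>A\<close> decides neither \<open>K\<close> nor its complement. Extending it to the full
  powerset in both ways gives \<open>\<mu>\<close> and \<open>\<nu>\<close>.\<close>

lemma algebra_ultrafilter_separation:
  assumes A: "algebra \<Omega> A" and K: "K \<subseteq> \<Omega>" "K \<notin> A"
  obtains \<mu> \<nu> where "\<mu> \<in> ultrafilters \<Omega>" "\<nu> \<in> ultrafilters \<Omega>" "holds_in (\<mu>, \<nu>) A" "K \<in> \<mu>" "K \<notin> \<nu>"
proof -
  interpret algebra \<Omega> A by fact
  \<comment> \<open>The complements of the ideal generated by the members of \<open>A\<close> that lie in \<open>K\<close> or miss it.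
    It is proper since \<open>K \<notin> A\<close>, and every \<open>Z \<in> A\<close> outside it meets both \<open>K\<close> and its complement.\<close>
  let ?C = "{\<Omega> - (X \<union> Y) | X Y. X \<in> A \<and> Y \<in> A \<and> X \<subseteq> K \<and> Y \<inter> K = {}}"
  have C_ne: "{} \<notin> ?C"
  proof
    assume "{} \<in> ?C"
    then obtain X Y where "X \<in> A" "X \<subseteq> K" "Y \<inter> K = {}" "\<Omega> - (X \<union> Y) = {}" by auto
    moreover from this have "X = K" using K(1) by blast
    ultimately show False using K(2) by blast
  qed
  have C_Int: "Z \<inter> Z' \<in> ?C" if ZZ: "Z \<in> ?C" "Z' \<in> ?C" for Z Z'
  proof -
    obtain X Y X' Y' where XY: "Z = \<Omega> - (X \<union> Y)" "X \<in> A" "Y \<in> A" "X \<subseteq> K" "Y \<inter> K = {}"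
      "Z' = \<Omega> - (X' \<union> Y')" "X' \<in> A" "Y' \<in> A" "X' \<subseteq> K" "Y' \<inter> K = {}" using ZZ by auto
    then have "Z \<inter> Z' = \<Omega> - ((X \<union> X') \<union> (Y \<union> Y'))" by blast
    moreover have "X \<union> X' \<in> A" "Y \<union> Y' \<in> A" "X \<union> X' \<subseteq> K" "(Y \<union> Y') \<inter> K = {}" using XY by blast+
    ultimately show ?thesis by blast
  qed
  have C_top: "\<Omega> \<in> ?C" using empty_sets by force
  have C_sub: "?C \<subseteq> Pow \<Omega>" by blast
  obtain \<rho> where \<rho>: "\<rho> \<in> ultrafilters \<Omega>" "?C \<subseteq> \<rho>"
    by (rule ultrafilter_extension[OF C_sub C_top C_ne C_Int])
  \<comment> \<open>Only the trace of \<open>\<rho>\<close> on \<open>A\<close> is kept: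
    \<open>\<rho>\<close> itself already decides \<open>K\<close>, whereas this trace is compatible
    with both \<open>K\<close> and \<open>\<Omega> - K\<close>.\<close>
  let ?D = "\<rho> \<inter> A"
  have D: "?D \<subseteq> Pow \<Omega>" "\<Omega> \<in> ?D" "\<And>X Y. X \<in> ?D \<Longrightarrow> Y \<in> ?D \<Longrightarrow> X \<inter> Y \<in> ?D"
    using ultrafilter_space[OF \<rho>(1)] ultrafilter_Int[OF \<rho>(1)] space_closed top by blast+
  have extend: "\<exists>\<mu>\<in>ultrafilters \<Omega>. ?D \<subseteq> \<mu> \<and> E \<in> \<mu>"
    if E: "E \<subseteq> \<Omega>" "\<And>Z. Z \<in> ?D \<Longrightarrow> Z \<inter> E \<noteq> {}" for E
  proof -
    let ?F = "?D \<union> (\<lambda>Z. Z \<inter> E) ` ?D"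
    have F_ne: "{} \<notin> ?F" using E(2) ultrafilter_not_empty[OF \<rho>(1)] by blast
    have F_sub: "?F \<subseteq> Pow \<Omega>" and F_top: "\<Omega> \<in> ?F" using D(1,2) by blast+
    obtain \<mu> where "\<mu> \<in> ultrafilters \<Omega>" "?F \<subseteq> \<mu>"
      by (rule ultrafilter_extension[OF F_sub F_top F_ne Int_closed_adjoin[OF D(3)]])
    moreover have "E \<in> ?F" using D(2) E(1) by (metis Int_absorb1 UnI2 imageI)
    ultimately show ?thesis by blast
  qed
  have "Z \<inter> K \<noteq> {} \<and> Z \<inter> (\<Omega> - K) \<noteq> {}" if Z: "Z \<in> ?D" for Z
  proof -
    have "\<Omega> - Z \<notin> ?C"
      using Z \<rho> ultrafilter_Compl_iff[OF \<rho>(1), of Z] space_closed by blast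
    \<comment> \<open>The two decompositions show that \<open>\<Omega> - Z\<close> would belong to
      \<open>?C\<close> if \<open>Z\<close> missed \<open>K\<close> (first form) or lay inside
      \<open>K\<close> (second form).\<close>
    moreover have "\<Omega> - Z = \<Omega> - ({} \<union> Z)" "\<Omega> - Z = \<Omega> - (Z \<union> {})" by blast+
    ultimately have "\<not> Z \<inter> K = {}" "\<not> Z \<subseteq> K"
      using Z empty_sets by blast+
    then show ?thesis using Z D(1) by blast
  qed
  then obtain \<mu> \<nu> where \<mu>: "\<mu> \<in> ultrafilters \<Omega>" "?D \<subseteq> \<mu>" "K \<in> \<mu>"
    and \<nu>: "\<nu> \<in> ultrafilters \<Omega>" "?D \<subseteq> \<nu>" "\<Omega> - K \<in> \<nu>"
    using extend[OF K(1)] extend[of "\<Omega> - K"] by (metis Diff_subset)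
  \<comment> \<open>Since \<open>A\<close> is closed under complement, containing \<open>?D\<close>
    already fixes an ultrafilter on all of \<open>A\<close>.\<close>
  have agree: "X \<in> \<sigma> \<longleftrightarrow> X \<in> \<rho>" if "\<sigma> \<in> ultrafilters \<Omega>" "?D \<subseteq> \<sigma>" "X \<in> A" for \<sigma> X
  proof -
    have "X \<subseteq> \<Omega>" "\<Omega> - X \<in> A" using that(3) space_closed by blast+
    then show ?thesis
      using that ultrafilter_Compl_iff[OF \<rho>(1)] ultrafilter_Compl_iff[OF that(1)] by blast
  qed
  have "holds_in (\<mu>, \<nu>) A"
    unfolding holds_in_def satisfies_eq_def using agree[OF \<mu>(1,2)] agree[OF \<nu>(1,2)] by simp
  moreover have "K \<notin> \<nu>" using \<nu>(3) ultrafilter_Compl_iff[OF \<nu>(1) K(1)] by blast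
  ultimately show ?thesis using that \<mu>(1,3) \<nu>(1) by blast
qed

section \<open>Generated Boolean algebras\<close>

text \<open>The subsets of \<open>\<Omega>\<close> on which two ultrafilters agree form an algebra,
  so it suffices to test generators.\<close>

lemma holds_in_algebra_hull:
  assumes \<mu>: "\<mu> \<in> ultrafilters \<Omega>" and \<nu>: "\<nu> \<in> ultrafilters \<Omega>"
    and G: "G \<subseteq> Pow \<Omega>" "holds_in (\<mu>, \<nu>) G"
  shows "holds_in (\<mu>, \<nu>) (algebra \<Omega> hull G)"
proof -
  let ?A = "{X. X \<subseteq> \<Omega> \<and> satisfies_eq X (\<mu>, \<nu>)}"
  have "algebra \<Omega> ?A"
    unfolding algebra_iff_Int satisfies_eq_def
    using ultrafilter_not_empty[OF \<mu>] ultrafilter_not_empty[OF \<nu>]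
    by (auto simp: ultrafilter_Compl_iff[OF \<mu>] ultrafilter_Compl_iff[OF \<nu>]
        ultrafilter_Int_iff[OF \<mu>] ultrafilter_Int_iff[OF \<nu>])
  moreover have "G \<subseteq> ?A" using G unfolding holds_in_def by blast
  ultimately have "algebra \<Omega> hull G \<subseteq> ?A" by (rule hull_minimal[rotated])
  then show ?thesis unfolding holds_in_def by blast
qed

lemma algebra_hull_is_algebra:
  assumes "G \<subseteq> Pow \<Omega>"
  shows "algebra \<Omega> (algebra \<Omega> hull G)"
proof -
  have mem: "X \<in> algebra \<Omega> hull G \<longleftrightarrow> (\<forall>A. algebra \<Omega> A \<longrightarrow> G \<subseteq> A \<longrightarrow> X \<in> A)" for X
    by (auto simp: hull_def)
  \<comment> \<open>The hull is an intersection of algebras; \<open>Pow \<Omega>\<close> is one of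
    those containing \<open>G\<close>, so the intersection is not over an empty family and stays
    within \<open>Pow \<Omega>\<close>.\<close>
  have "algebra \<Omega> (Pow \<Omega>)" by (auto simp: algebra_iff_Un)
  then have "algebra \<Omega> hull G \<subseteq> Pow \<Omega>" using assms by (rule hull_minimal[rotated])
  moreover have "{} \<in> algebra \<Omega> hull G"
    "\<forall>X\<in>algebra \<Omega> hull G. \<Omega> - X \<in> algebra \<Omega> hull G"
    "\<forall>X\<in>algebra \<Omega> hull G. \<forall>Y\<in>algebra \<Omega> hull G. X \<union> Y \<in> algebra \<Omega> hull G"
    by (simp_all add: mem algebra_iff_Un Ball_def)
  ultimately show ?thesis
    by (simp add: algebra_iff_Un[of \<Omega> "algebra \<Omega> hull G"])
qed

section \<open>Marked products and the generators of the extended algebra\<close>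

lemma replace_letter_Pi: "a \<in> \<Sigma> \<Longrightarrow> replace_letter a \<in> pointed_words \<Sigma> \<rightarrow> lists \<Sigma>"
  using set_update_subset_insert by (fastforce simp: replace_letter_def pointed_words_def in_lists_conv_set)

text \<open>A word \<open>u @ [a] @ v\<close> is its own preimage when pointed at
  \<open>length u\<close>, where replacing by \<open>a\<close> changes nothing. Conversely,
  replacing the pointed letter leaves the prefix before it intact.\<close>

lemma marked_product_eq_image:
  assumes "a \<in> \<Sigma>" "L \<subseteq> lists \<Sigma>"
  shows "marked_product L a (lists \<Sigma>) =
    replace_letter a ` {x \<in> pointed_words \<Sigma>. prefix_before x \<in> L}"
proof (intro equalityI subsetI)
  fix w assume "w \<in> marked_product L a (lists \<Sigma>)"
  then obtain u v where uv: "w = u @ [a] @ v" "u \<in> L" "v \<in> lists \<Sigma>"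
    unfolding marked_product_def by blast
  then have "(w, length u) \<in> {x \<in> pointed_words \<Sigma>. prefix_before x \<in> L}"
    "w = replace_letter a (w, length u)"
    using assms by (auto simp: pointed_words_def prefix_before_def replace_letter_def)
  then show "w \<in> replace_letter a ` {x \<in> pointed_words \<Sigma>. prefix_before x \<in> L}" by blast
next
  fix w assume "w \<in> replace_letter a ` {x \<in> pointed_words \<Sigma>. prefix_before x \<in> L}"
  then obtain v i where v: "v \<in> lists \<Sigma>" "i < length v" "take i v \<in> L" "w = v[i := a]"
    by (auto simp: pointed_words_def prefix_before_def replace_letter_def)
  then have "w = take i v @ [a] @ drop (Suc i) v" "drop (Suc i) v \<in> lists \<Sigma>"
    by (auto simp: upd_conv_take_nth_drop in_lists_conv_set dest: in_set_dropD)
  then show "w \<in> marked_product L a (lists \<Sigma>)"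
    unfolding marked_product_def using v(3) by blast
qed

definition oplus_two_generators :: "'a set \<Rightarrow> 'a list set set \<Rightarrow> 'a list set set" where
  "oplus_two_generators \<Sigma> B = B \<union> {{}, lists \<Sigma>} \<union>
     {marked_product L1 a L2 | L1 a L2. L1 \<in> B \<and> a \<in> \<Sigma> \<and> L2 \<in> {{}, lists \<Sigma>}}"

lemma oplus_two_eq_hull: "oplus_two \<Sigma> B = algebra (lists \<Sigma>) hull oplus_two_generators \<Sigma> B"
  unfolding oplus_two_def oplus_def oplus_two_generators_def ..

lemma oplus_two_generators_subset:
  assumes "B \<subseteq> Pow (lists \<Sigma>)"
  shows "oplus_two_generators \<Sigma> B \<subseteq> Pow (lists \<Sigma>)"
proof -
  have "marked_product L1 a L2 \<subseteq> lists \<Sigma>" if "L1 \<subseteq> lists \<Sigma>" "a \<in> \<Sigma>" "L2 \<subseteq> lists \<Sigma>" for L1 a L2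
    using that by (fastforce simp: marked_product_def)
  then show ?thesis
    using assms unfolding oplus_two_generators_def by blast
qed

section \<open>The equations as agreement on the generators\<close>

text \<open>Both directions lift an ultrafilter along \<open>replace_letter a\<close>: from left to
  right \<open>\<nu>\<close> is lifted subject to all prefix conditions met by
  \<open>\<gamma>\<close>, from right to left \<open>\<mu>\<close> is lifted subject to the single
  condition given by \<open>L\<close>. Only one implication between \<open>\<mu>\<close> and
  \<open>\<nu>\<close> is involved, so that exchanging them covers the symmetric clause.\<close>

lemma marked_product_agree_iff_lift:
  assumes B: "algebra (lists \<Sigma>) B" and a: "a \<in> \<Sigma>"
    and \<mu>: "\<mu> \<in> ultrafilters (lists \<Sigma>)" and \<nu>: "\<nu> \<in> ultrafilters (lists \<Sigma>)"
  shows "(\<forall>L\<in>B. marked_product L a (lists \<Sigma>) \<in> \<mu> \<longrightarrow> marked_product L a (lists \<Sigma>) \<in> \<nu>) \<longleftrightarrow>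
    (\<forall>\<gamma>\<in>ultrafilters (pointed_words \<Sigma>). \<mu> = beta_replace \<Sigma> a \<gamma> \<longrightarrow>
       (\<exists>\<delta>\<in>ultrafilters (pointed_words \<Sigma>). \<nu> = beta_replace \<Sigma> a \<delta> \<and>
          holds_in (beta_prefix \<Sigma> \<gamma>, beta_prefix \<Sigma> \<delta>) B))" (is "?agree \<longleftrightarrow> ?lift")
proof
  interpret algebra "lists \<Sigma>" B by fact
  let ?S = "pointed_words \<Sigma>" and ?pre = "\<lambda>L. {x \<in> pointed_words \<Sigma>. prefix_before x \<in> L}"
  note mp = marked_product_eq_image[OF a] and Pi = replace_letter_Pi[OF a]
  have L_sub: "L \<subseteq> lists \<Sigma>" if "L \<in> B" for L using that space_closed by blast
  have prefix_in: "prefix_before x \<in> lists \<Sigma>" if "x \<in> ?S" for x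
    using that by (auto simp: prefix_before_def pointed_words_def in_lists_conv_set dest: in_set_takeD)
  {
    assume agree: ?agree
    show ?lift
    proof (intro ballI impI)
      fix \<gamma> assume \<gamma>: "\<gamma> \<in> ultrafilters ?S" and \<mu>_eq: "\<mu> = beta_replace \<Sigma> a \<gamma>"
      \<comment> \<open>These are the prefix conditions from \<open>B\<close> that
        \<open>\<gamma>\<close> satisfies. Their images are marked products in \<open>\<mu>\<close>,
        hence in \<open>\<nu>\<close> by \<open>agree\<close>, which is what lifting
        \<open>\<nu>\<close> requires.\<close>
      let ?D = "{?pre L | L. L \<in> B \<and> ?pre L \<in> \<gamma>}"
      have D_img: "replace_letter a ` D \<in> \<nu>" if "D \<in> ?D" for D
      proof -
        obtain L where L: "L \<in> B" "D = ?pre L" "D \<in> \<gamma>" using \<open>D \<in> ?D\<close> by auto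
        then have "marked_product L a (lists \<Sigma>) \<in> \<mu>"
          using image_in_ultrafilter_map[OF \<gamma> Pi L(3)] mp[OF L_sub] \<mu>_eq by simp
        then show ?thesis using agree L mp[OF L_sub] by auto
      qed
      have D_Int: "D \<inter> D' \<in> ?D" if DD: "D \<in> ?D" "D' \<in> ?D" for D D'
      proof -
        obtain L L' where L: "L \<in> B" "D = ?pre L" "D \<in> \<gamma>" "L' \<in> B" "D' = ?pre L'" "D' \<in> \<gamma>"
          using DD by auto
        have eq: "D \<inter> D' = ?pre (L \<inter> L')" using L(2,5) by blast
        have "?pre (L \<inter> L') \<in> \<gamma>" using ultrafilter_Int[OF \<gamma> L(3,6)] eq by simp
        then show ?thesis
          unfolding eq using Int[OF L(1,4)] by (intro CollectI exI[of _ "L \<inter> L'"] conjI refl)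
      qed
      have D_top: "?S \<in> ?D"
      proof -
        have eq: "?pre (lists \<Sigma>) = ?S" using prefix_in by blast
        show ?thesis
          by (intro CollectI exI[of _ "lists \<Sigma>"] conjI) (simp_all only: eq top ultrafilter_space[OF \<gamma>])
      qed
      have D_sub: "?D \<subseteq> Pow ?S" by blast
      obtain \<delta> where \<delta>: "\<delta> \<in> ultrafilters ?S" "?D \<subseteq> \<delta>" "\<nu> = beta_replace \<Sigma> a \<delta>"
        by (rule ultrafilter_map_lift[OF \<nu> Pi D_sub D_top D_Int D_img])
      \<comment> \<open>The inclusion of \<open>?D\<close> in \<open>\<delta>\<close> gives one
        implication; applied to the complement \<open>lists \<Sigma> - L\<close>, again in
        \<open>B\<close>, it gives the other.\<close>
      have "?pre L \<in> \<gamma> \<longleftrightarrow> ?pre L \<in> \<delta>" if L: "L \<in> B" for L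
      proof -
        have sub: "?pre L \<subseteq> ?S" by blast
        have eq: "?S - ?pre L = ?pre (lists \<Sigma> - L)" using prefix_in by blast
        have "lists \<Sigma> - L \<in> B" using L by blast
        then have "?S - ?pre L \<in> \<gamma> \<longrightarrow> ?S - ?pre L \<in> \<delta>" "?pre L \<in> \<gamma> \<longrightarrow> ?pre L \<in> \<delta>"
          using \<delta>(2) L unfolding eq by blast+
        then show ?thesis
          unfolding ultrafilter_Compl_iff[OF \<gamma> sub] ultrafilter_Compl_iff[OF \<delta>(1) sub] by blast
      qed
      then have "holds_in (beta_prefix \<Sigma> \<gamma>, beta_prefix \<Sigma> \<delta>) B"
        by (simp add: holds_in_def satisfies_eq_def ultrafilter_map_def)
      then show "\<exists>\<delta>\<in>ultrafilters ?S. \<nu> = beta_replace \<Sigma> a \<delta> \<and>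
          holds_in (beta_prefix \<Sigma> \<gamma>, beta_prefix \<Sigma> \<delta>) B" using \<delta> by blast
    qed
  next
    assume lift: ?lift
    show ?agree
    proof (intro ballI impI)
      fix L assume L: "L \<in> B" and in_\<mu>: "marked_product L a (lists \<Sigma>) \<in> \<mu>"
      have img: "replace_letter a ` ?pre L \<in> \<mu>" using in_\<mu> mp[OF L_sub[OF L]] by simp
      \<comment> \<open>The lifting lemma wants the whole space in its family, so \<open>?S\<close>
        accompanies \<open>?pre L\<close>.\<close>
      have "replace_letter a ` ?S \<in> \<mu>"
        by (rule ultrafilter_mono[OF \<mu> img]) (use Pi in blast)+
      then have D_img: "\<And>D. D \<in> {?S, ?pre L} \<Longrightarrow> replace_letter a ` D \<in> \<mu>"
        using img by blast
      have D_Int: "\<And>X Y. X \<in> {?S, ?pre L} \<Longrightarrow> Y \<in> {?S, ?pre L} \<Longrightarrow> X \<inter> Y \<in> {?S, ?pre L}"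
        by blast
      have D_sub: "{?S, ?pre L} \<subseteq> Pow ?S" and D_top: "?S \<in> {?S, ?pre L}" by blast+
      obtain \<gamma> where \<gamma>: "\<gamma> \<in> ultrafilters ?S" "{?S, ?pre L} \<subseteq> \<gamma>" "\<mu> = beta_replace \<Sigma> a \<gamma>"
        by (rule ultrafilter_map_lift[OF \<mu> Pi D_sub D_top D_Int D_img])
      obtain \<delta> where \<delta>: "\<delta> \<in> ultrafilters ?S" "\<nu> = beta_replace \<Sigma> a \<delta>"
        "holds_in (beta_prefix \<Sigma> \<gamma>, beta_prefix \<Sigma> \<delta>) B"
        using lift \<gamma>(1,3) by blast
      then have "?pre L \<in> \<delta>"
        using L L_sub[OF L] \<gamma>(2) by (auto simp: holds_in_def satisfies_eq_def ultrafilter_map_def)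
      then show "marked_product L a (lists \<Sigma>) \<in> \<nu>"
        using image_in_ultrafilter_map[OF \<delta>(1) Pi] \<delta>(2) mp[OF L_sub[OF L]] by simp
    qed
  }
qed

text \<open>The third clause of the definition keeps \<open>\<gamma>\<close> on the left although
  \<open>\<delta>\<close> is the given ultrafilter; symmetry turns it into the second clause with
  \<open>\<mu>\<close> and \<open>\<nu>\<close> exchanged.\<close>

lemma holds_in_commute: "holds_in (\<mu>, \<nu>) B \<longleftrightarrow> holds_in (\<nu>, \<mu>) B"
  by (auto simp: holds_in_def satisfies_eq_def)

text \<open>The first clause is agreement on \<open>B\<close>, and the two lifting clauses are the
  two implications for the marked products with second factor \<open>lists \<Sigma>\<close>.
  Together they express agreement on the generators, which passes to the generated algebra.\<close>

lemma equations_oplus_two_eq: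
  assumes B: "algebra (lists \<Sigma>) B"
  shows "equations_oplus_two \<Sigma> B = {(\<mu>, \<nu>). \<mu> \<in> ultrafilters (lists \<Sigma>) \<and>
    \<nu> \<in> ultrafilters (lists \<Sigma>) \<and> holds_in (\<mu>, \<nu>) (oplus_two \<Sigma> B)}"
proof -
  have "(\<mu>, \<nu>) \<in> equations_oplus_two \<Sigma> B \<longleftrightarrow> holds_in (\<mu>, \<nu>) (oplus_two \<Sigma> B)"
    if \<mu>: "\<mu> \<in> ultrafilters (lists \<Sigma>)" and \<nu>: "\<nu> \<in> ultrafilters (lists \<Sigma>)" for \<mu> \<nu>
  proof -
    have Bsub: "B \<subseteq> Pow (lists \<Sigma>)" using B by (simp add: algebra_iff_Un)
    have "(\<mu>, \<nu>) \<in> equations_oplus_two \<Sigma> B \<longleftrightarrow> holds_in (\<mu>, \<nu>) B \<and>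
      (\<forall>a\<in>\<Sigma>. \<forall>L\<in>B. marked_product L a (lists \<Sigma>) \<in> \<mu> \<longrightarrow> marked_product L a (lists \<Sigma>) \<in> \<nu>) \<and>
      (\<forall>a\<in>\<Sigma>. \<forall>L\<in>B. marked_product L a (lists \<Sigma>) \<in> \<nu> \<longrightarrow> marked_product L a (lists \<Sigma>) \<in> \<mu>)"
      using \<mu> \<nu>
      by (simp add: equations_oplus_two_def marked_product_agree_iff_lift[OF B _ \<mu> \<nu>]
          marked_product_agree_iff_lift[OF B _ \<nu> \<mu>]
          holds_in_commute[of "beta_prefix \<Sigma> \<gamma>" "beta_prefix \<Sigma> \<delta>" for \<gamma> \<delta>] cong: ball_cong)
    also have "\<dots> \<longleftrightarrow> holds_in (\<mu>, \<nu>) (oplus_two_generators \<Sigma> B)"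
    proof -
      \<comment> \<open>Ultrafilters always agree on \<open>{}\<close> and on the whole space, and a
        product with \<open>{}\<close> is \<open>{}\<close>; agreement on the remaining generators
        is the condition just obtained.\<close>
      have "marked_product L a {} = {}" for L :: "'a list set" and a
        by (simp add: marked_product_def)
      moreover have "holds_in e (oplus_two_generators \<Sigma> B) \<longleftrightarrow> holds_in e B \<and>
        satisfies_eq {} e \<and> satisfies_eq (lists \<Sigma>) e \<and> (\<forall>a\<in>\<Sigma>. \<forall>L\<in>B.
          satisfies_eq (marked_product L a {}) e \<and> satisfies_eq (marked_product L a (lists \<Sigma>)) e)" for e
        unfolding holds_in_def oplus_two_generators_def by blast
      ultimately show ?thesis
        using ultrafilter_space[OF \<mu>] ultrafilter_space[OF \<nu>]
          ultrafilter_not_empty[OF \<mu>] ultrafilter_not_empty[OF \<nu>]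
        by (auto simp: satisfies_eq_def)
    qed
    also have "\<dots> \<longleftrightarrow> holds_in (\<mu>, \<nu>) (oplus_two \<Sigma> B)"
      unfolding oplus_two_eq_hull
      using holds_in_algebra_hull[OF \<mu> \<nu> oplus_two_generators_subset[OF Bsub]]
        hull_subset[of "oplus_two_generators \<Sigma> B" "algebra (lists \<Sigma>)"]
      unfolding holds_in_def by blast
    finally show ?thesis .
  qed
  then show ?thesis unfolding equations_oplus_two_def by blast
qed

theorem theorem6p3:
  fixes \<Sigma> :: "'a set" and B :: "'a list set set" and K :: "'a list set"
  assumes "finite \<Sigma>"
    and "algebra (lists \<Sigma>) B"
    and "closed_under_quotients \<Sigma> B"
    and "K \<subseteq> lists \<Sigma>"
  shows "K \<in> oplus_two \<Sigma> B \<longleftrightarrow> (\<forall>e \<in> equations_oplus_two \<Sigma> B. satisfies_eq K e)"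
proof
  assume "K \<in> oplus_two \<Sigma> B"
  then show "\<forall>e \<in> equations_oplus_two \<Sigma> B. satisfies_eq K e"
    unfolding equations_oplus_two_eq[OF assms(2)] holds_in_def by blast
next
  assume eqs: "\<forall>e \<in> equations_oplus_two \<Sigma> B. satisfies_eq K e"
  have "B \<subseteq> Pow (lists \<Sigma>)" using assms(2) by (simp add: algebra_iff_Un)
  then have alg: "algebra (lists \<Sigma>) (oplus_two \<Sigma> B)"
    unfolding oplus_two_eq_hull by (intro algebra_hull_is_algebra oplus_two_generators_subset)
  show "K \<in> oplus_two \<Sigma> B"
  proof (rule ccontr)
    assume "K \<notin> oplus_two \<Sigma> B"
    \<comment> \<open>A pair that agrees on \<open>oplus_two \<Sigma> B\<close> but not on
      \<open>K\<close> is an equation that \<open>K\<close> violates.\<close>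
    then obtain \<mu> \<nu> where "\<mu> \<in> ultrafilters (lists \<Sigma>)" "\<nu> \<in> ultrafilters (lists \<Sigma>)"
      "holds_in (\<mu>, \<nu>) (oplus_two \<Sigma> B)" and K: "K \<in> \<mu>" "K \<notin> \<nu>"
      by (rule algebra_ultrafilter_separation[OF alg assms(4)])
    then have "(\<mu>, \<nu>) \<in> equations_oplus_two \<Sigma> B"
      by (simp add: equations_oplus_two_eq[OF assms(2)])
    then have "satisfies_eq K (\<mu>, \<nu>)" using eqs by blast
    then show False using K by (simp add: satisfies_eq_def)
  qed
qed

end
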